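(* Let $-1\neq L>-3/2$ if $\eta\in\mathbb{R}\setminus\{0\}$, and $L>-3/2$ if $\eta=0$. Then for $\rho\neq0$, $$\lim_{n\to\infty}\sqrt{(2L+3)(2L+2n+1)}\;C_{L+n}(\eta)\,\rho^{L+n}\,R_{n-1}^{(L)}(\eta;\rho)=\sqrt{1+\frac{\eta^{2}}{(L+1)^{2}}}\;F_L(\eta,\rho).$$
   Context: $\mathbb{Z}_+=\{0,1,2,\dots\}$. Put $$w_n=\frac{\sqrt{(n+1)^2+\eta^2}}{(n+1)\sqrt{(2n+1)(2n+3)}},\qquad \lambda_n=-\frac{\eta}{n(n+1)}$$ for $n=L,L+1,L+2,\dots$ (so $\lambda_n=0$ if $\eta=0$). The polynomials $P_n^{(L)}(\eta;z)$ in $z$ are given by $P_{-1}^{(L)}(\eta;z)=0$, $P_0^{(L)}(\eta;z)=1$ and the three-term recurrence $$zP_n^{(L)}(\eta;z)=w_{L+n}P_{n-1}^{(L)}(\eta;z)+\lambda_{L+n+1}P_n^{(L)}(\eta;z)+w_{L+n+1}P_{n+1}^{(L)}(\eta;z),\quad n\in\mathbb{Z}_+$$ (for $n=0$ the first term on the right is absent because $P_{-1}^{(L)}=0$). One sets $R_n^{(L)}(\eta;\rho)=P_n^{(L)}(\eta;\rho^{-1})$ for $\rho\neq0$, $n\in\mathbb{Z}_+$. The regular Coulomb wave function is $F_L(\eta,\rho)=C_L(\eta)\,\rho^{L+1}\phi_L(\eta,\rho)$, where $$\phi_L(\eta,\rho)=e^{-i\rho}\,{}_1F_1(L+1-i\eta,2L+2,2i\rho),\qquad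 C_L(\eta)=\frac{2^{L}e^{-\pi\eta/2}\,|\Gamma(L+1+i\eta)|}{\Gamma(2L+2)},$$ and ${}_1F_1$ is the confluent hypergeometric function.
   Formalization: For -3/2<L<-1 the right side gets a factor -1: there Γ(2L+2)<0 makes C_L(η) negative while C_{L+n}(η)>0 for n≥1, so the stated sign fails. At L=-1, η=0, where C_L and φ_L are undefined, their limits as L→-1 from above (1 and cos ρ) are used. *)

theory Defs
  imports "HOL-Analysis.Analysis"
begin

definition coulomb_w :: "real \<Rightarrow> real \<Rightarrow> real" where
  "coulomb_w \<eta> x = sqrt ((x + 1)\<^sup>2 + \<eta>\<^sup>2) / ((x + 1) * sqrt ((2 * x + 1) * (2 * x + 3)))"

text \<open>For \<open>\<eta> = 0\<close> this is \<open>0\<close> also at \<open>x = 0\<close>, since \<open>0 / 0 = 0\<close>.\<close>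

definition coulomb_lambda :: "real \<Rightarrow> real \<Rightarrow> real" where
  "coulomb_lambda \<eta> x = - \<eta> / (x * (x + 1))"

text \<open>The three-term recurrence, solved for the polynomial of highest degree.\<close>

fun coulomb_P :: "real \<Rightarrow> real \<Rightarrow> nat \<Rightarrow> complex poly" where
  "coulomb_P L \<eta> 0 = 1"
| "coulomb_P L \<eta> (Suc 0) =
     smult (1 / of_real (coulomb_w \<eta> (L + 1))) [:- of_real (coulomb_lambda \<eta> (L + 1)), 1:]"
| "coulomb_P L \<eta> (Suc (Suc n)) =
     smult (1 / of_real (coulomb_w \<eta> (L + real n + 2)))
       ([:- of_real (coulomb_lambda \<eta> (L + real n + 2)), 1:] * coulomb_P L \<eta> (Suc n)
        - smult (of_real (coulomb_w \<eta> (L + real n + 1))) (coulomb_P L \<eta> n))"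

lemma coulomb_w_pos: "coulomb_w \<eta> x > 0" if "x > - 1 / 2"
proof -
  have "(x + 1)\<^sup>2 + \<eta>\<^sup>2 > 0" using that by (intro add_pos_nonneg) auto
  moreover have "x + 1 > 0" "(2 * x + 1) * (2 * x + 3) > 0" using that by auto
  ultimately show ?thesis by (simp add: coulomb_w_def)
qed

lemma coulomb_P_recurrence:
  assumes "L > - 3 / 2"
  shows "z * poly (coulomb_P L \<eta> n) z =
           (if n = 0 then 0 else of_real (coulomb_w \<eta> (L + real n)) * poly (coulomb_P L \<eta> (n - 1)) z)
           + of_real (coulomb_lambda \<eta> (L + real n + 1)) * poly (coulomb_P L \<eta> n) z
           + of_real (coulomb_w \<eta> (L + real n + 1)) * poly (coulomb_P L \<eta> (n + 1)) z"
proof -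
  have w: "coulomb_w \<eta> (L + real n + 1) \<noteq> 0" for n
    using coulomb_w_pos[of "L + real n + 1" \<eta>] assms by simp
  show ?thesis
  proof (cases n)
    case 0
    thus ?thesis using w[of 0] by (simp add: field_simps)
  next
    case (Suc m)
    thus ?thesis using w[of n] by (simp add: field_simps)
  qed
qed

definition coulomb_R :: "real \<Rightarrow> real \<Rightarrow> nat \<Rightarrow> complex \<Rightarrow> complex" where
  "coulomb_R L \<eta> n \<rho> = poly (coulomb_P L \<eta> n) (1 / \<rho>)"

definition hypergeo_1F1 :: "complex \<Rightarrow> complex \<Rightarrow> complex \<Rightarrow> complex" where
  "hypergeo_1F1 a b z = eval_fps (fps_hypergeo [a] [b] 1) z"

text \<open>
  At \<open>L = - 1\<close>, \<open>\<eta> = 0\<close> the usual expressions for the normalising constant and for the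
  confluent hypergeometric function have the indeterminate forms \<open>\<Gamma>(0) / \<Gamma>(0)\<close> and
  \<open>1F1(0, 0, _)\<close>. There we take their limits as \<open>L\<close> tends to \<open>- 1\<close> from above, see
  \<open>coulomb_C_limit\<close> and \<open>coulomb_phi_limit\<close> below.

  For \<open>- 3/2 < L < - 1\<close> the factor \<open>\<Gamma>(2 L + 2)\<close> is negative, and hence so is the
  normalising constant at \<open>L\<close>, whatever \<open>\<eta>\<close> is, while those at \<open>L + 1\<close>, \<open>L + 2\<close>, ...
  and all the weights \<open>coulomb_w\<close> occurring in the recurrence are positive. Identities
  relating \<open>L\<close> to \<open>L + n\<close> can therefore carry an additional sign in this range of \<open>L\<close>.
\<close>

definition coulomb_C :: "real \<Rightarrow> real \<Rightarrow> real" where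
  "coulomb_C L \<eta> =
     (if L = -1 \<and> \<eta> = 0 then 1
      else 2 powr L * exp (- pi * \<eta> / 2) * norm (Gamma (Complex (L + 1) \<eta>)) / Gamma (2 * L + 2))"

definition coulomb_phi :: "real \<Rightarrow> real \<Rightarrow> complex \<Rightarrow> complex" where
  "coulomb_phi L \<eta> \<rho> =
     (if L = -1 \<and> \<eta> = 0 then cos \<rho>
      else exp (- \<i> * \<rho>)
             * hypergeo_1F1 (of_real (L + 1) - \<i> * of_real \<eta>) (of_real (2 * L + 2)) (2 * \<i> * \<rho>))"

definition coulomb_F :: "real \<Rightarrow> real \<Rightarrow> complex \<Rightarrow> complex" where
  "coulomb_F L \<eta> \<rho> = of_real (coulomb_C L \<eta>) * \<rho> powr of_real (L + 1) * coulomb_phi L \<eta> \<rho>"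

lemma coulomb_C_limit: "((\<lambda>L. coulomb_C L 0) \<longlongrightarrow> coulomb_C (-1) 0) (at_right (-1))"
proof -
  define g :: "real \<Rightarrow> real" where
    "g L = 2 powr L * (2 * Gamma (L + 2) / Gamma (2 * L + 3))" for L
  have eq: "coulomb_C L 0 = g L" if "L > -1" for L
  proof -
    have nz: "L + 1 \<noteq> 0" "2 * L + 2 \<noteq> 0" using that by auto
    have "Gamma (L + 1 + 1) = (L + 1) * Gamma (L + 1)"
      using that by (intro Gamma_plus1) (auto dest: nonpos_Ints_nonpos)
    moreover have "Gamma (2 * L + 2 + 1) = (2 * L + 2) * Gamma (2 * L + 2)"
      using that by (intro Gamma_plus1) (auto dest: nonpos_Ints_nonpos)
    moreover have "norm (Gamma (Complex (L + 1) 0)) = Gamma (L + 1)"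
    proof -
      have "Complex (L + 1) 0 = of_real (L + 1)" by (simp add: complex_eq_iff)
      thus ?thesis
        using Gamma_real_pos[of "L + 1"] that by (simp only: Gamma_complex_of_real norm_of_real) simp
    qed
    moreover have "Gamma (2 * L + 2) > 0"
      using that by (intro Gamma_real_pos) auto
    moreover have "2 * Gamma (L + 2) / Gamma (2 * L + 3) = Gamma (L + 1) / Gamma (2 * L + 2)"
    proof -
      have "2 * Gamma (L + 2) / Gamma (2 * L + 3)
              = ((2 * L + 2) * Gamma (L + 1)) / ((2 * L + 2) * Gamma (2 * L + 2))"
        using calculation by (simp add: add.assoc algebra_simps)
      thus ?thesis using nz by simp
    qed
    ultimately show ?thesis
      using that by (simp add: coulomb_C_def g_def)
  qed
  have "(g \<longlongrightarrow> 2 powr (-1) * (2 * Gamma (-1 + 2) / Gamma (2 * (-1) + 3))) (at_right (-1))"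
    unfolding g_def by (intro tendsto_intros) (auto simp: Gamma_eq_zero_iff)
  hence "(g \<longlongrightarrow> coulomb_C (-1) 0) (at_right (-1))"
    by (simp add: coulomb_C_def powr_minus)
  moreover have "eventually (\<lambda>L. g L = coulomb_C L 0) (at_right (-1))"
    using eq by (auto simp: eventually_at_right_less eventually_at_filter)
  ultimately show ?thesis
    by (rule Lim_transform_eventually)
qed

lemma coulomb_phi_limit:
  "((\<lambda>L. coulomb_phi L 0 \<rho>) \<longlongrightarrow> coulomb_phi (-1) 0 \<rho>) (at_right (-1))"
proof -
  define z where "z = 2 * \<i> * \<rho>"
  define c :: "real \<Rightarrow> nat \<Rightarrow> real" where
    "c L n = (if n = 0 then 1 else 1 / 2 * (pochhammer (L + 2) (n - 1) / pochhammer (2 * L + 3) (n - 1)))" for L n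
  define a where "a n L = of_real (c L n) * (z ^ n / fact n)" for n L
  define b where "b n = (if n = 0 then 1 else 1 / 2) * (z ^ n / fact n)" for n :: nat
  have phi: "coulomb_phi L 0 \<rho> = exp (- \<i> * \<rho>) * (\<Sum>n. a n L)" if L: "L > -1" for L
  proof -
    have "pochhammer (complex_of_real (L + 1)) n / pochhammer (complex_of_real (2 * L + 2)) n
            = of_real (c L n)" for n
    proof (cases n)
      case (Suc m)
      have "pochhammer (L + 1) n / pochhammer (2 * L + 2) n
              = ((L + 1) * pochhammer (L + 2) m) / ((L + 1) * (2 * pochhammer (2 * L + 3) m))"
        by (simp add: Suc pochhammer_rec add.assoc algebra_simps)
      also have "\<dots> = c L n" using L by (simp add: c_def Suc)
      finally show ?thesis unfolding pochhammer_of_real by (simp flip: of_real_divide)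
    qed (simp add: c_def)
    hence "fps_nth (fps_hypergeo [of_real (L + 1)] [of_real (2 * L + 2)] 1) n * z ^ n = a n L" for n
      unfolding a_def by (simp flip: times_divide_eq_left divide_divide_eq_left)
    thus ?thesis using L
      by (simp add: coulomb_phi_def hypergeo_1F1_def eval_fps_def z_def)
  qed
  have lim: "((\<lambda>L. a n L) \<longlongrightarrow> b n) (at_right (-1))" for n
  proof (cases n)
    case (Suc m)
    have p: "pochhammer (1 :: real) m \<noteq> 0" by (simp flip: pochhammer_fact)
    have "((\<lambda>L. pochhammer (L + 2) m) \<longlongrightarrow> pochhammer (-1 + 2 :: real) m) (at_right (-1))"
      unfolding pochhammer_prod by (intro tendsto_intros)
    moreover have "((\<lambda>L. pochhammer (2 * L + 3) m) \<longlongrightarrow> pochhammer (2 * (-1) + 3 :: real) m) (at_right (-1))"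
      unfolding pochhammer_prod by (intro tendsto_intros)
    ultimately have "((\<lambda>L. 1 / 2 * (pochhammer (L + 2) m / pochhammer (2 * L + 3) m)) \<longlongrightarrow>
        1 / 2 * (pochhammer (-1 + 2) m / pochhammer (2 * (-1) + 3) m)) (at_right (-1 :: real))"
      using p by (intro tendsto_mult tendsto_divide tendsto_const) auto
    hence "((\<lambda>L. c L n) \<longlongrightarrow> 1 / 2) (at_right (-1))" using p by (simp add: c_def Suc)
    hence "((\<lambda>L. a n L) \<longlongrightarrow> of_real (1 / 2) * (z ^ n / fact n)) (at_right (-1))"
      unfolding a_def by (intro tendsto_intros)
    thus ?thesis by (simp add: b_def Suc)
  qed (simp add: a_def b_def c_def)
  have bd: "norm (a n L) \<le> norm z ^ n / fact n" if L: "L > -1" for n L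
  proof -
    have "0 \<le> c L n \<and> c L n \<le> 1"
    proof (cases n)
      case (Suc m)
      have "0 \<le> pochhammer (L + 2) m" using L by (intro pochhammer_nonneg) simp
      moreover have "pochhammer (L + 2) m \<le> pochhammer (2 * L + 3) m"
        unfolding pochhammer_prod using L by (intro prod_mono) auto
      moreover have "0 < pochhammer (2 * L + 3) m" using L by (intro pochhammer_pos) simp
      ultimately show ?thesis by (simp add: c_def Suc field_simps)
    qed (simp add: c_def)
    hence "\<bar>c L n\<bar> * (norm z ^ n / fact n) \<le> 1 * (norm z ^ n / fact n)"
      by (intro mult_right_mono) auto
    thus ?thesis by (simp add: a_def norm_mult norm_divide norm_power)
  qed
  have ev: "eventually (\<lambda>L. L > -1) (at_right (-1 :: real))"
    by (simp add: eventually_at_right_less)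
  have "((\<lambda>L. \<Sum>n. a n L) \<longlongrightarrow> (\<Sum>n. b n)) (at_right (-1))"
  proof (rule tannerys_theorem[THEN conjunct2, THEN conjunct2])
    show "summable (\<lambda>n. norm z ^ n / fact n)"
      using summable_exp[of "norm z"] by (simp add: field_simps)
    show "\<forall>\<^sub>F (k, n) in at_top \<times>\<^sub>F at_right (-1). norm (a k n) \<le> norm z ^ k / fact k"
      unfolding eventually_prod_filter using ev bd
      by (intro exI[of _ "\<lambda>_. True"] exI[of _ "\<lambda>L. L > -1"]) auto
  qed (use lim in auto)
  moreover have "(\<Sum>n. b n) = (1 + exp z) / 2"
  proof -
    have "(\<lambda>n. z ^ n / fact n) sums exp z"
      using exp_converges[of z] by (simp add: scaleR_conv_of_real field_simps)
    moreover have "(\<lambda>n. if n = 0 then 1 else 0 :: complex) sums 1"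
      using sums_single[of 0 "\<lambda>_. 1 :: complex"] by simp
    ultimately have "(\<lambda>n. (z ^ n / fact n + (if n = 0 then 1 else 0)) / 2) sums ((exp z + 1) / 2)"
      by (intro sums_divide sums_add)
    moreover have "(z ^ n / fact n + (if n = 0 then 1 else 0)) / 2 = b n" for n
      by (auto simp: b_def)
    ultimately show ?thesis by (simp add: sums_iff add.commute)
  qed
  ultimately have "((\<lambda>L. exp (- \<i> * \<rho>) * (\<Sum>n. a n L))
                     \<longlongrightarrow> exp (- \<i> * \<rho>) * ((1 + exp z) / 2)) (at_right (-1))"
    by (intro tendsto_intros) auto
  moreover have "exp (- \<i> * \<rho>) * ((1 + exp z) / 2) = coulomb_phi (-1) 0 \<rho>"
    by (simp add: coulomb_phi_def cos_exp_eq z_def ring_distribs add.commute flip: exp_add)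
  moreover have "eventually (\<lambda>L. exp (- \<i> * \<rho>) * (\<Sum>n. a n L) = coulomb_phi L 0 \<rho>) (at_right (-1))"
    using ev by eventually_elim (simp add: phi)
  ultimately show ?thesis
    by (auto intro: Lim_transform_eventually)
qed

end

theory Submission
  imports Defs "HOL-Real_Asymp.Real_Asymp"
begin

text \<open>
  A contiguous relation of 1F1 gives the three-term relation
  \<open>\<phi>\<^sub>L = (1 - \<lambda>\<^sub>L\<^sub>+\<^sub>1 \<rho>) \<phi>\<^sub>L\<^sub>+\<^sub>1 - w\<^sub>L\<^sub>+\<^sub>1\<^sup>2 \<rho>\<^sup>2 \<phi>\<^sub>L\<^sub>+\<^sub>2\<close>. After multiplication by \<open>\<rho>\<^sup>n w\<^sub>L\<^sub>+\<^sub>1 \<dots> w\<^sub>L\<^sub>+\<^sub>n\<close>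
  the \<open>R\<^sub>n\<close> become the continuants of this relation. Since \<open>\<Sum> \<bar>\<lambda>\<^sub>L\<^sub>+\<^sub>n\<bar>\<close> and \<open>\<Sum> w\<^sub>L\<^sub>+\<^sub>n\<^sup>2\<close> converge, the
  continuants are bounded, and since \<open>\<phi>\<^sub>L\<^sub>+\<^sub>n\<close> tends to 1 they tend to \<open>\<phi>\<^sub>L\<close>. The remaining factor
  does not depend on \<open>n\<close>, because \<open>sqrt (2 L + 3) C\<^sub>L\<^sub>+\<^sub>1 = sqrt (2 L + 1) w\<^sub>L C\<^sub>L\<close>.
\<close>

section \<open>Three-term recurrences with summable perturbations\<close>

text \<open>A discrete Gronwall argument: the recurrence perturbs
  \<open>y (n + 2) = y (n + 1)\<close>, and one step enlarges the maximum of two consecutive norms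
  by a factor of at most \<open>1 + a n \<le> exp (a n)\<close>, where \<open>a\<close> is
  summable.\<close>

lemma perturbed_recurrence_bounded:
  fixes y \<beta> \<gamma> :: "nat \<Rightarrow> 'a :: real_normed_algebra_1"
  assumes rec: "\<And>n. y (n + 2) = \<beta> (n + 1) * y (n + 1) - \<gamma> n * y n"
    and sum_\<beta>: "summable (\<lambda>n. norm (\<beta> n - 1))" and sum_\<gamma>: "summable (\<lambda>n. norm (\<gamma> n))"
  shows "Bseq y"
proof -
  define a where "a n = norm (\<beta> (n + 1) - 1) + norm (\<gamma> n)" for n
  define B where "B n = max (norm (y 0)) (norm (y 1)) * exp (\<Sum>k<n. a k)" for n
  have a_nonneg: "a n \<ge> 0" for n by (simp add: a_def)
  have B_nonneg: "B n \<ge> 0" for n by (simp add: B_def le_max_iff_disj)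
  have B_Suc: "(1 + a n) * B n \<le> B (Suc n)" for n
  proof -
    have "(1 + a n) * B n \<le> exp (a n) * B n"
      by (intro mult_right_mono exp_ge_add_one_self B_nonneg)
    also have "\<dots> = B (Suc n)" by (simp add: B_def exp_add)
    finally show ?thesis .
  qed
  have bound: "norm (y n) \<le> B n \<and> norm (y (n + 1)) \<le> B n" for n
  proof (induction n)
    case 0
    show ?case by (simp add: B_def)
  next
    case (Suc n)
    have "norm (\<beta> (n + 1)) \<le> norm (\<beta> (n + 1) - 1) + 1"
      using norm_triangle_ineq[of "\<beta> (n + 1) - 1" 1] by simp
    hence "norm (\<beta> (n + 1) * y (n + 1)) \<le> (norm (\<beta> (n + 1) - 1) + 1) * B n"
      using Suc by (intro order.trans[OF norm_mult_ineq] mult_mono) auto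
    moreover have "norm (\<gamma> n * y n) \<le> norm (\<gamma> n) * B n"
      using Suc by (intro order.trans[OF norm_mult_ineq] mult_left_mono) auto
    moreover have "norm (y (n + 2)) \<le> norm (\<beta> (n + 1) * y (n + 1)) + norm (\<gamma> n * y n)"
      unfolding rec by (rule norm_triangle_ineq4)
    ultimately have "norm (y (n + 2)) \<le> (1 + a n) * B n"
      by (simp add: a_def algebra_simps)
    moreover have "B n \<le> (1 + a n) * B n"
      using a_nonneg[of n] B_nonneg[of n] by (simp add: algebra_simps)
    ultimately show ?case using Suc B_Suc[of n] by auto
  qed
  have "summable a"
    unfolding a_def using sum_\<beta> sum_\<gamma> summable_Suc_iff[of "\<lambda>n. norm (\<beta> n - 1)"]
    by (intro summable_add) auto
  hence "(\<Sum>k<n. a k) \<le> suminf a" for n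
    using a_nonneg by (intro sum_le_suminf) auto
  hence "B n \<le> max (norm (y 0)) (norm (y 1)) * exp (suminf a)" for n
    unfolding B_def by (intro mult_left_mono) (auto simp: max_def)
  thus ?thesis using bound by (intro BseqI') (blast intro: order.trans)
qed

text \<open>
  The \<open>y n\<close> are the continuants of the three-term relation satisfied by \<open>f\<close>, so that
  \<open>f 0 = y (n + 1) * f (n + 1) - \<gamma> n * y n * f (n + 2)\<close>.
\<close>

lemma continuants_tendsto:
  fixes y f \<beta> \<gamma> :: "nat \<Rightarrow> 'a :: real_normed_field"
  assumes f_rec: "\<And>n. f n = \<beta> n * f (n + 1) - \<gamma> n * f (n + 2)"
    and y0: "y 0 = 1" and y1: "y 1 = \<beta> 0"
    and y_rec: "\<And>n. y (n + 2) = \<beta> (n + 1) * y (n + 1) - \<gamma> n * y n"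
    and sum_\<beta>: "summable (\<lambda>n. norm (\<beta> n - 1))" and sum_\<gamma>: "summable (\<lambda>n. norm (\<gamma> n))"
    and f_lim: "f \<longlonglongrightarrow> 1"
  shows "y \<longlonglongrightarrow> f 0"
proof -
  have expand: "f 0 = y (n + 1) * f (n + 1) - \<gamma> n * y n * f (n + 2)" for n
  proof (induction n)
    case 0
    show ?case using f_rec[of 0] by (simp add: y0 y1[simplified])
  next
    case (Suc n)
    have "f 0 = y (n + 1) * (\<beta> (n + 1) * f (n + 2) - \<gamma> (n + 1) * f (n + 3)) - \<gamma> n * y n * f (n + 2)"
      using Suc f_rec[of "n + 1"] by (simp add: eval_nat_numeral)
    also have "\<dots> = y (n + 2) * f (n + 2) - \<gamma> (n + 1) * y (n + 1) * f (n + 3)"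
      by (simp only: y_rec) (simp add: algebra_simps)
    finally show ?case by (simp add: eval_nat_numeral)
  qed
  have f_lim1: "(\<lambda>n. f (n + 1)) \<longlonglongrightarrow> 1" and f_lim2: "(\<lambda>n. f (n + 2)) \<longlonglongrightarrow> 1"
    using f_lim by (blast intro: LIMSEQ_ignore_initial_segment)+
  have "\<gamma> \<longlonglongrightarrow> 0"
    using summable_LIMSEQ_zero[OF sum_\<gamma>] by (rule tendsto_norm_zero_cancel)
  moreover have "Bseq y"
    by (rule perturbed_recurrence_bounded[OF y_rec sum_\<beta> sum_\<gamma>])
  ultimately have "(\<lambda>n. \<gamma> n * y n) \<longlonglongrightarrow> 0"
    using bounded_bilinear.Zfun_prod_Bfun[OF bounded_bilinear_mult, of \<gamma> sequentially y]
    by (simp add: tendsto_Zfun_iff)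
  \<comment> \<open>\<open>expand\<close> is solved for \<open>y (n + 1)\<close>; the division is
    legitimate for large \<open>n\<close> because \<open>f\<close> tends to 1.\<close>
  hence "(\<lambda>n. (f 0 + \<gamma> n * y n * f (n + 2)) / f (n + 1)) \<longlonglongrightarrow> (f 0 + 0 * 1) / 1"
    using f_lim1 f_lim2 by (intro tendsto_intros) auto
  moreover have "eventually (\<lambda>n. f (n + 1) \<noteq> 0) sequentially"
    using tendsto_imp_eventually_ne[OF f_lim1, of 0] by simp
  hence "eventually (\<lambda>n. (f 0 + \<gamma> n * y n * f (n + 2)) / f (n + 1) = y (n + 1)) sequentially"
  proof eventually_elim
    case (elim n)
    thus ?case using expand[of n] by (simp add: divide_eq_eq)
  qed
  ultimately have "(\<lambda>n. y (n + 1)) \<longlonglongrightarrow> f 0"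
    by (auto intro: Lim_transform_eventually)
  thus ?thesis by (simp only: LIMSEQ_offset)
qed

section \<open>Power series of the Coulomb functions\<close>

text \<open>
  For \<open>L \<noteq> -1\<close> this is the ratio of the Pochhammer symbols of \<open>L + 1 - \<i> \<eta>\<close> and \<open>2 L + 2\<close>,
  with the factor \<open>(L + 1 - \<i> \<eta>) / (2 L + 2)\<close> split off. At \<open>L = -1\<close>, \<open>\<eta> = 0\<close>
  the convention \<open>0 / 0 = 0\<close> turns that factor into its limit \<open>1 / 2\<close>.
\<close>

definition coulomb_coeff :: "real \<Rightarrow> real \<Rightarrow> nat \<Rightarrow> complex" where
  "coulomb_coeff L \<eta> n =
     (case n of 0 \<Rightarrow> 1
      | Suc m \<Rightarrow> (1 - \<i> * of_real (\<eta> / (L + 1))) / 2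
           * (pochhammer (of_real (L + 2) - \<i> * of_real \<eta>) m / pochhammer (of_real (2 * L + 3)) m))"

lemma coulomb_coeff_conv_pochhammer:
  assumes "L \<noteq> -1"
  shows "coulomb_coeff L \<eta> n
    = pochhammer (of_real (L + 1) - \<i> * of_real \<eta>) n / pochhammer (of_real (2 * L + 2)) n"
proof (cases n)
  case (Suc m)
  have nz: "complex_of_real L + 1 \<noteq> 0"
    using assms by (metis of_real_eq_0_iff of_real_1 of_real_add add_eq_0_iff2)
  have "of_real (L + 1) - \<i> * of_real \<eta> + 1 = of_real (L + 2) - \<i> * complex_of_real \<eta>"
    "complex_of_real (2 * L + 2) + 1 = of_real (2 * L + 3)"
    by simp_all
  hence "pochhammer (of_real (L + 1) - \<i> * of_real \<eta>) n / pochhammer (of_real (2 * L + 2)) n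
     = (of_real (L + 1) - \<i> * of_real \<eta>) / of_real (2 * L + 2)
         * (pochhammer (of_real (L + 2) - \<i> * of_real \<eta>) m / pochhammer (of_real (2 * L + 3)) m)"
    by (simp only: Suc pochhammer_rec times_divide_times_eq)
  moreover have "(of_real (L + 1) - \<i> * of_real \<eta>) / of_real (2 * L + 2)
     = (1 - \<i> * complex_of_real (\<eta> / (L + 1))) / 2"
  proof -
    have "complex_of_real (2 * L + 2) = 2 * (of_real L + 1)" by simp
    thus ?thesis using nz by (simp add: field_simps)
  qed
  ultimately show ?thesis by (simp only: coulomb_coeff_def Suc nat.case)
qed (simp add: coulomb_coeff_def)

text \<open>The products are compared factor by factor; \<open>C \<ge> 1\<close> absorbs the shift
  by \<open>k\<close>.\<close>

lemma norm_pochhammer_divide_le: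
  fixes a :: complex and b C :: real
  assumes "b > 0" and "C \<ge> 1" and "norm a \<le> C * b"
  shows "norm (pochhammer a n / pochhammer (of_real b) n) \<le> C ^ n"
proof -
  have "norm (a + of_nat k) \<le> C * norm (of_real b + of_nat k :: complex)" for k
  proof -
    have "norm (a + of_nat k) \<le> norm a + real k"
      using norm_triangle_ineq[of a "of_nat k"] by simp
    also have "\<dots> \<le> C * b + C * real k"
      using assms mult_right_mono[of 1 C "real k"] by simp
    also have "\<dots> = C * norm (of_real (b + real k) :: complex)"
      using assms by (simp only: norm_of_real) (simp add: algebra_simps)
    finally show ?thesis by simp
  qed
  hence "norm (pochhammer a n) \<le> (\<Prod>k<n. C * norm (of_real b + of_nat k :: complex))"
    unfolding pochhammer_prod prod_norm[symmetric] atLeast0LessThan by (intro prod_mono) auto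
  also have "\<dots> = C ^ n * norm (pochhammer (of_real b :: complex) n)"
    by (simp add: prod.distrib pochhammer_prod prod_norm atLeast0LessThan)
  finally have "norm (pochhammer a n) \<le> C ^ n * norm (pochhammer (of_real b :: complex) n)" .
  moreover have "pochhammer (complex_of_real b) n \<noteq> 0"
    using pochhammer_pos[OF assms(1), of n] by (simp add: pochhammer_of_real)
  ultimately show ?thesis by (simp add: norm_divide divide_le_eq)
qed

text \<open>Uniformity in \<open>L\<close> supplies the majorant for Tannery's theorem when
  \<open>L\<close> is replaced by \<open>L + n\<close>. The assumption makes the norm of
  \<open>L + 1 - \<i> * \<eta>\<close> at most \<open>2 * L + 2\<close>, so the previous bound holds
  with \<open>C = 1\<close>.\<close>

lemma norm_coulomb_coeff_le:
  assumes "L + 1 > \<bar>\<eta>\<bar>"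
  shows "norm (coulomb_coeff L \<eta> n) \<le> 1"
proof -
  have "norm (of_real (L + 1) - \<i> * complex_of_real \<eta>) \<le> \<bar>L + 1\<bar> + \<bar>\<eta>\<bar>"
    by (rule order.trans[OF norm_triangle_ineq4]) (simp only: norm_mult norm_of_real, simp)
  also have "\<dots> \<le> 1 * (2 * L + 2)" using assms by simp
  finally have "norm (pochhammer (of_real (L + 1) - \<i> * complex_of_real \<eta>) n
      / pochhammer (of_real (2 * L + 2)) n) \<le> 1 ^ n"
    using assms by (intro norm_pochhammer_divide_le) auto
  moreover have "L \<noteq> -1" using assms by auto
  ultimately show ?thesis by (metis coulomb_coeff_conv_pochhammer power_one)
qed

text \<open>For \<open>L \<le> -1\<close> the number \<open>2 * L + 2\<close> is not positive. The
  Pochhammer bound is therefore applied after splitting off the first factor, with base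
  \<open>2 * L + 3 > 0\<close>; geometric growth of the coefficients is beaten by
  \<open>fact n\<close>.\<close>

lemma summable_coulomb_coeff:
  assumes "L > -3/2"
  shows "summable (\<lambda>n. coulomb_coeff L \<eta> n * (z ^ n / fact n))"
proof -
  define a where "a = of_real (L + 2) - \<i> * complex_of_real \<eta>"
  define r where "r = (1 - \<i> * complex_of_real (\<eta> / (L + 1))) / 2"
  define C where "C = max 1 (norm a / (2 * L + 3))"
  define M where "M = max 1 (norm r)"
  have b: "2 * L + 3 > 0" using assms by simp
  have "norm a \<le> C * (2 * L + 3)" using b by (simp add: C_def max_def divide_simps)
  hence poch: "norm (pochhammer a m / pochhammer (of_real (2 * L + 3)) m) \<le> C ^ m" for m
    using b by (intro norm_pochhammer_divide_le) (auto simp: C_def)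
  have bound: "norm (coulomb_coeff L \<eta> n) \<le> M * C ^ n" for n
  proof (cases n)
    case (Suc m)
    have "norm (coulomb_coeff L \<eta> n) = norm r * norm (pochhammer a m / pochhammer (of_real (2 * L + 3)) m)"
      by (simp only: Suc coulomb_coeff_def nat.case a_def r_def norm_mult)
    also have "\<dots> \<le> M * C ^ m"
      using poch[of m] by (intro mult_mono) (auto simp: M_def)
    also have "\<dots> \<le> M * C ^ n"
      using Suc by (intro mult_left_mono power_increasing) (auto simp: C_def M_def)
    finally show ?thesis .
  qed (simp add: coulomb_coeff_def M_def)
  show ?thesis
  proof (rule summable_comparison_test')
    show "summable (\<lambda>n. M * ((C * norm z) ^ n / fact n))"
      using summable_exp[of "C * norm z"] by (intro summable_mult) (simp add: field_simps)
    fix n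
    have "norm (coulomb_coeff L \<eta> n * (z ^ n / fact n)) \<le> M * C ^ n * (norm z ^ n / fact n)"
      using mult_right_mono[OF bound, of "norm z ^ n / fact n" n]
      by (simp add: norm_mult norm_divide norm_power)
    thus "norm (coulomb_coeff L \<eta> n * (z ^ n / fact n)) \<le> M * ((C * norm z) ^ n / fact n)"
      by (simp add: power_mult_distrib)
  qed
qed

lemma exp_sums_complex: "(\<lambda>n. z ^ n / fact n) sums exp (z :: complex)"
  using exp_converges[of z] by (simp add: scaleR_conv_of_real field_simps)

text \<open>Multiplying by \<open>exp (\<i> * \<rho>)\<close> cancels the exponential in
  \<open>coulomb_phi\<close> and leaves the bare 1F1 series, in a form that also covers
  \<open>L = -1\<close>, \<open>\<eta> = 0\<close>.\<close>

lemma coulomb_phi_series: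
  fixes \<rho> :: complex
  assumes "L > -3/2" and "\<eta> \<noteq> 0 \<Longrightarrow> L \<noteq> -1"
  shows "(\<lambda>n. coulomb_coeff L \<eta> n * ((2 * \<i> * \<rho>) ^ n / fact n)) sums (exp (\<i> * \<rho>) * coulomb_phi L \<eta> \<rho>)"
proof (cases "L = -1")
  case True
  hence \<eta>: "\<eta> = 0" using assms by auto
  define z where "z = 2 * \<i> * \<rho>"
  \<comment> \<open>At the exceptional point the coefficients are 1 for \<open>n = 0\<close> and 1/2
    afterwards; the sum is \<open>exp (\<i> * \<rho>) * cos \<rho>\<close>.\<close>
  have "(\<lambda>n. (z ^ n / fact n + (if n = 0 then 1 else 0)) / 2) sums ((exp z + 1) / 2)"
    using exp_sums_complex[of z] sums_single[of 0 "\<lambda>_. 1 :: complex"]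
    by (intro sums_divide sums_add) auto
  moreover have "(z ^ n / fact n + (if n = 0 then 1 else 0)) / 2 = coulomb_coeff L \<eta> n * (z ^ n / fact n)" for n
    using True \<eta>
    by (auto simp: coulomb_coeff_def split: nat.split simp flip: pochhammer_fact)
  moreover have "exp (\<i> * \<rho>) * coulomb_phi L \<eta> \<rho> = (exp z + 1) / 2"
    using True \<eta> by (simp add: coulomb_phi_def cos_exp_eq z_def ring_distribs mult.assoc flip: exp_add)
  ultimately show ?thesis unfolding z_def by (simp only:)
next
  case False
  have "coulomb_coeff L \<eta> n * (z ^ n / fact n)
      = fps_nth (fps_hypergeo [of_real (L + 1) - \<i> * of_real \<eta>] [of_real (2 * L + 2)] 1) n * z ^ n" for n z
    unfolding coulomb_coeff_conv_pochhammer[OF False] by simp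
  moreover from this have "exp (\<i> * \<rho>) * coulomb_phi L \<eta> \<rho> = (\<Sum>n. coulomb_coeff L \<eta> n * ((2 * \<i> * \<rho>) ^ n / fact n))"
    using False by (simp add: coulomb_phi_def hypergeo_1F1_def eval_fps_def flip: exp_add mult.assoc)
  ultimately show ?thesis
    using summable_sums[OF summable_coulomb_coeff[OF assms(1), of \<eta> "2 * \<i> * \<rho>"]] by (simp only:)
qed

section \<open>Contiguous relation and three-term relation in the order\<close>

lemma coulomb_w_squared:
  assumes "x > -1/2"
  shows "(coulomb_w \<eta> x)\<^sup>2 = ((x + 1)\<^sup>2 + \<eta>\<^sup>2) / ((x + 1)\<^sup>2 * ((2 * x + 1) * (2 * x + 3)))"
  using assms by (simp add: coulomb_w_def power_divide power_mult_distrib)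

text \<open>This is \<open>coulomb_phi_rec\<close> times \<open>exp (\<i> * \<rho>)\<close>, read
  off in powers of \<open>z = 2 * \<i> * \<rho>\<close>. Multiplication by \<open>z\<close> and
  \<open>z\<^sup>2\<close> shifts \<open>z ^ n / fact n\<close>, whence the factors
  \<open>n + 2\<close> and \<open>(n + 2) * (n + 1)\<close>. Degree 1 is separate because the
  \<open>coulomb_w\<close> term starts at degree 2.\<close>

lemma coulomb_coeff_contiguous:
  assumes "L > -3/2" and "\<eta> \<noteq> 0 \<Longrightarrow> L \<noteq> -1"
  shows "coulomb_coeff L \<eta> 1 = coulomb_coeff (L + 1) \<eta> 1
      + \<i> / 2 * of_real (coulomb_lambda \<eta> (L + 1))" (is ?thesis1)
    and "coulomb_coeff L \<eta> (n + 2) = coulomb_coeff (L + 1) \<eta> (n + 2)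
      + of_nat (n + 2) * (\<i> / 2 * of_real (coulomb_lambda \<eta> (L + 1))) * coulomb_coeff (L + 1) \<eta> (n + 1)
      + of_nat ((n + 2) * (n + 1)) * (of_real ((coulomb_w \<eta> (L + 1))\<^sup>2) / 4) * coulomb_coeff (L + 2) \<eta> n"
      (is ?thesis2)
proof -
  \<comment> \<open>Once the Pochhammer products cancel, only rational functions of
    \<open>b\<close>, \<open>s\<close> and \<open>N\<close> remain. With \<open>s\<close> in place
    of \<open>\<eta>\<close> the formula for \<open>a\<close> needs no division by
    \<open>L + 1\<close> and survives \<open>L = -1\<close>, where \<open>\<eta> = 0\<close> and
    \<open>s = 0\<close>.\<close>
  define b where "b = complex_of_real (2 * L + 4)"
  define s where "s = - \<i> * complex_of_real (\<eta> / (L + 1))"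
  define a where "a = (b + (b - 2) * s) / 2"
  define N where "N = complex_of_nat n"
  have b_plus: "b + of_real x \<noteq> 0" if "x \<ge> -1" for x
  proof -
    have "complex_of_real (2 * L + 4 + x) \<noteq> 0" using that assms(1) by (subst of_real_eq_0_iff) auto
    thus ?thesis by (simp add: b_def)
  qed
  have nz: "b \<noteq> 0" "b + 1 \<noteq> 0" "b - 1 \<noteq> 0" "b + N \<noteq> 0" "b + N + 1 \<noteq> 0"
    using b_plus[of 0] b_plus[of 1] b_plus[of "-1"] b_plus[of "real n"] b_plus[of "real n + 1"]
    by (auto simp: N_def algebra_simps)
  have a: "of_real (L + 2) - \<i> * of_real \<eta> = a"
  proof -
    have "(L + 1) * (\<eta> / (L + 1)) = \<eta>"
      using assms(2) by (cases "L + 1 = 0") (auto simp: eq_neg_iff_add_eq_0)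
    hence "complex_of_real (L + 1) * of_real (\<eta> / (L + 1)) = of_real \<eta>" by (metis of_real_mult)
    moreover have "(b - 2) * s = - 2 * \<i> * (complex_of_real (L + 1) * of_real (\<eta> / (L + 1)))"
      by (simp add: b_def s_def algebra_simps del: of_real_divide)
    ultimately have "(b - 2) * s = - 2 * \<i> * of_real \<eta>" by (simp only:)
    thus ?thesis unfolding a_def by (simp only:) (simp add: b_def)
  qed
  have \<lambda>: "\<i> / 2 * of_real (coulomb_lambda \<eta> (L + 1)) = s / b"
  proof -
    have "coulomb_lambda \<eta> (L + 1) = - (2 * (\<eta> / (L + 1)) / (2 * L + 4))"
      using assms(1) by (simp add: coulomb_lambda_def divide_simps)
    thus ?thesis by (simp only:) (simp add: s_def b_def)
  qed
  have w: "of_real ((coulomb_w \<eta> (L + 1))\<^sup>2) / 4 = a * (b - a) / (b\<^sup>2 * (b - 1) * (b + 1))"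
  proof -
    have "(coulomb_w \<eta> (L + 1))\<^sup>2 = ((L + 2)\<^sup>2 + \<eta>\<^sup>2) / ((L + 2)\<^sup>2 * ((2 * L + 3) * (2 * L + 5)))"
      using coulomb_w_squared[of "L + 1" \<eta>] assms(1) by (simp add: algebra_simps)
    also have "\<dots> / 4 = ((L + 2)\<^sup>2 + \<eta>\<^sup>2) / ((2 * L + 4)\<^sup>2 * (2 * L + 4 - 1) * (2 * L + 4 + 1))"
      using assms(1) by (simp add: divide_simps) (simp add: power2_eq_square algebra_simps)
    finally have w4: "(coulomb_w \<eta> (L + 1))\<^sup>2 / 4
        = ((L + 2)\<^sup>2 + \<eta>\<^sup>2) / ((2 * L + 4)\<^sup>2 * (2 * L + 4 - 1) * (2 * L + 4 + 1))" .
    have "of_real ((coulomb_w \<eta> (L + 1))\<^sup>2 / 4) = of_real ((L + 2)\<^sup>2 + \<eta>\<^sup>2) / (b\<^sup>2 * (b - 1) * (b + 1))"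
      unfolding w4 by (simp add: b_def)
    \<comment> \<open>\<open>b - a\<close> is the complex conjugate of \<open>a\<close>.\<close>
    moreover have "of_real ((L + 2)\<^sup>2 + \<eta>\<^sup>2) = a * (b - a)"
      by (simp add: b_def power2_eq_square algebra_simps flip: a)
    moreover have "of_real ((coulomb_w \<eta> (L + 1))\<^sup>2) / 4 = complex_of_real ((coulomb_w \<eta> (L + 1))\<^sup>2 / 4)"
      by simp
    ultimately show ?thesis by (simp only:)
  qed
  have L: "L + 1 \<noteq> -1" "L + 2 \<noteq> -1" using assms(1) by auto
  have c1: "coulomb_coeff (L + 1) \<eta> k = pochhammer a k / pochhammer b k" for k
    using coulomb_coeff_conv_pochhammer[OF L(1), of \<eta> k]
    by (simp add: b_def algebra_simps flip: a)
  have c2: "coulomb_coeff (L + 2) \<eta> k = pochhammer (a + 1) k / pochhammer (b + 2) k" for k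
    using coulomb_coeff_conv_pochhammer[OF L(2), of \<eta> k]
    by (simp add: b_def algebra_simps flip: a)
  have c0: "coulomb_coeff L \<eta> (Suc k) = (1 + s) / 2 * (pochhammer a k / pochhammer (b - 1) k)" for k
  proof -
    have b: "complex_of_real (2 * L + 3) = b - 1" by (simp add: b_def)
    show ?thesis unfolding coulomb_coeff_def nat.case a b s_def by simp
  qed
  show ?thesis1
    using nz(1) unfolding \<lambda> c1 by (simp add: c0 a_def field_simps)
  \<comment> \<open>All four terms of the relation are rational multiples of
    \<open>a * A / D\<close>.\<close>
  define A where "A = pochhammer (a + 1) n"
  define D where "D = pochhammer b n"
  have D: "D \<noteq> 0"
    using pochhammer_pos[of "2 * L + 4" n] assms(1) unfolding D_def b_def pochhammer_of_real by simp
  have a1: "pochhammer a (n + 1) = a * A" by (simp add: A_def pochhammer_rec)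
  have a2: "pochhammer a (n + 2) = a * A * (a + N + 1)"
    using a1 pochhammer_Suc[of a "n + 1"] by (simp add: N_def add.assoc add.commute)
  have b1: "pochhammer b (n + 1) = D * (b + N)" by (simp add: D_def N_def pochhammer_Suc)
  have b2: "pochhammer b (n + 2) = D * (b + N) * (b + N + 1)"
    using b1 pochhammer_Suc[of b "n + 1"] by (simp add: N_def add.assoc add.commute)
  have b3: "pochhammer (b - 1) (n + 1) = (b - 1) * D" by (simp add: D_def pochhammer_rec)
  have b4: "pochhammer (b + 2) n = D * (b + N) * (b + N + 1) / (b * (b + 1))"
  proof -
    have "pochhammer b (n + 2) = b * ((b + 1) * pochhammer (b + 2) n)"
      using pochhammer_rec[of b "n + 1"] pochhammer_rec[of "b + 1" n] by (simp add: add.assoc)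
    hence "pochhammer (b + 2) n * (b * (b + 1)) = D * (b + N) * (b + N + 1)"
      using b2 by (simp add: mult_ac)
    moreover have "b * (b + 1) \<noteq> 0" using nz by simp
    ultimately show ?thesis by (simp only: nonzero_eq_divide_eq not_False_eq_True)
  qed
  \<comment> \<open>The contiguous relation with the common factor \<open>a * A / D\<close>
    removed.\<close>
  have "(1 + s) / 2 / (b - 1) = (a + N + 1) / ((b + N) * (b + N + 1)) + (N + 2) * (s / b) / (b + N)
      + (N + 2) * (N + 1) * (b - a) / (b * (b - 1) * (b + N) * (b + N + 1))"
    using nz unfolding a_def by (simp add: divide_simps) algebra
  hence "(1 + s) / 2 / (b - 1) * (a * A / D) = (a + N + 1) / ((b + N) * (b + N + 1)) * (a * A / D)
      + (N + 2) * (s / b) / (b + N) * (a * A / D)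
      + (N + 2) * (N + 1) * (b - a) / (b * (b - 1) * (b + N) * (b + N + 1)) * (a * A / D)"
    by (simp only: distrib_right)
  moreover have "coulomb_coeff L \<eta> (n + 2) = (1 + s) / 2 / (b - 1) * (a * A / D)"
    using c0[of "n + 1"] a1 b3 by simp
  moreover have "coulomb_coeff (L + 1) \<eta> (n + 2) = (a + N + 1) / ((b + N) * (b + N + 1)) * (a * A / D)"
    unfolding c1 a2 b2 by (simp add: mult_ac)
  moreover have "(N + 2) * (s / b) * coulomb_coeff (L + 1) \<eta> (n + 1) = (N + 2) * (s / b) / (b + N) * (a * A / D)"
    unfolding c1 a1 b1 by (simp add: mult_ac)
  moreover have "(N + 2) * (N + 1) * (a * (b - a) / (b\<^sup>2 * (b - 1) * (b + 1))) * coulomb_coeff (L + 2) \<eta> n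
      = (N + 2) * (N + 1) * (b - a) / (b * (b - 1) * (b + N) * (b + N + 1)) * (a * A / D)"
    unfolding c2 b4 A_def[symmetric] using nz by (simp add: power2_eq_square mult_ac)
  moreover have "of_nat (n + 2) = N + 2" "of_nat ((n + 2) * (n + 1)) = (N + 2) * (N + 1)"
    by (simp_all add: N_def algebra_simps)
  ultimately show ?thesis2
    unfolding \<lambda> w by (simp only:)
qed

lemma coulomb_phi_rec:
  assumes "L > -3/2" and "\<eta> \<noteq> 0 \<Longrightarrow> L \<noteq> -1"
  shows "coulomb_phi L \<eta> \<rho> = (1 - of_real (coulomb_lambda \<eta> (L + 1)) * \<rho>) * coulomb_phi (L + 1) \<eta> \<rho>
     - \<rho>\<^sup>2 * of_real ((coulomb_w \<eta> (L + 1))\<^sup>2) * coulomb_phi (L + 2) \<eta> \<rho>"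
proof -
  define z where "z = 2 * \<i> * \<rho>"
  define \<kappa> where "\<kappa> = \<i> / 2 * complex_of_real (coulomb_lambda \<eta> (L + 1))"
  define \<omega> where "\<omega> = complex_of_real ((coulomb_w \<eta> (L + 1))\<^sup>2) / 4"
  define t where "t l n = coulomb_coeff l \<eta> n * (z ^ n / fact n)" for l n
  define S where "S l = exp (\<i> * \<rho>) * coulomb_phi l \<eta> \<rho>" for l
  have S: "t L sums S L" "t (L + 1) sums S (L + 1)" "t (L + 2) sums S (L + 2)"
    unfolding t_def S_def z_def using assms(1)
    by (auto simp del: times_divide_eq_right intro!: coulomb_phi_series assms(2))
  have split: "t L (n + 2) = t (L + 1) (n + 2) + \<kappa> * z * t (L + 1) (n + 1) + \<omega> * z\<^sup>2 * t (L + 2) n" for n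
  proof -
    define N N' where "N = complex_of_nat (n + 2)" and "N' = complex_of_nat (n + 1)"
    have N: "N \<noteq> 0" "N' \<noteq> 0" unfolding N_def N'_def of_nat_eq_0_iff by simp_all
    have fact: "fact (n + 1) = N' * fact n" "fact (n + 2) = N * (N' * fact n)"
      by (simp_all add: N_def N'_def algebra_simps)
    have "coulomb_coeff L \<eta> (n + 2) = coulomb_coeff (L + 1) \<eta> (n + 2)
        + N * \<kappa> * coulomb_coeff (L + 1) \<eta> (n + 1) + N * N' * \<omega> * coulomb_coeff (L + 2) \<eta> n"
      using coulomb_coeff_contiguous(2)[OF assms, where n = n]
      unfolding of_nat_mult N_def N'_def \<kappa>_def \<omega>_def by blast
    thus ?thesis
      unfolding t_def fact using N by (simp add: power2_eq_square field_simps)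
  qed
  \<comment> \<open>The coefficient relation starts at degree 2, so the terms of degree 0 and 1 are
    split off and compared separately; the middle series is shifted by one and loses only its first
    term.\<close>
  have "(\<lambda>n. t L (n + 2)) sums (S L - (t L 0 + t L 1))"
    using sums_split_initial_segment[OF S(1), of 2] by (simp add: eval_nat_numeral)
  moreover have "(\<lambda>n. t L (n + 2)) sums (S (L + 1) - (t (L + 1) 0 + t (L + 1) 1)
      + \<kappa> * z * (S (L + 1) - t (L + 1) 0) + \<omega> * z\<^sup>2 * S (L + 2))"
    unfolding split
    using sums_split_initial_segment[OF S(2), of 2] sums_split_initial_segment[OF S(2), of 1] S(3)
    by (intro sums_add sums_mult) (simp_all add: eval_nat_numeral)
  ultimately have "S L - (t L 0 + t L 1) = S (L + 1) - (t (L + 1) 0 + t (L + 1) 1)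
      + \<kappa> * z * (S (L + 1) - t (L + 1) 0) + \<omega> * z\<^sup>2 * S (L + 2)"
    by (rule sums_unique2)
  moreover have "t L 1 = t (L + 1) 1 + \<kappa> * z"
    using coulomb_coeff_contiguous(1)[OF assms] by (simp add: t_def \<kappa>_def algebra_simps)
  moreover have "t l 0 = 1" for l by (simp add: t_def coulomb_coeff_def)
  ultimately have "S L = (1 + \<kappa> * z) * S (L + 1) + \<omega> * z\<^sup>2 * S (L + 2)"
    by (simp add: algebra_simps)
  \<comment> \<open>The imaginary units cancel: \<open>\<i> / 2 * (2 * \<i>) = -1\<close> here, and
    \<open>(2 * \<i>)\<^sup>2 / 4 = -1\<close> for \<open>\<omega>\<close>.\<close>
  also have "\<kappa> * z = - of_real (coulomb_lambda \<eta> (L + 1)) * \<rho>"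
    by (simp add: \<kappa>_def z_def complex_eq_iff)
  also have "\<omega> * z\<^sup>2 = - (\<rho>\<^sup>2 * of_real ((coulomb_w \<eta> (L + 1))\<^sup>2))"
    by (simp add: \<omega>_def z_def power_mult_distrib)
  finally have "exp (\<i> * \<rho>) * coulomb_phi L \<eta> \<rho>
      = exp (\<i> * \<rho>) * ((1 - of_real (coulomb_lambda \<eta> (L + 1)) * \<rho>) * coulomb_phi (L + 1) \<eta> \<rho>
     - \<rho>\<^sup>2 * of_real ((coulomb_w \<eta> (L + 1))\<^sup>2) * coulomb_phi (L + 2) \<eta> \<rho>)"
    by (simp add: S_def algebra_simps)
  thus ?thesis by (subst (asm) mult_cancel_left) simp
qed

section \<open>Limits as the order tends to infinity\<close>

text \<open>For fixed \<open>k\<close> and large \<open>n\<close> the coefficient is a product of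
  \<open>k\<close> factors, each tending to 1/2.\<close>

lemma coulomb_coeff_tendsto: "(\<lambda>n. coulomb_coeff (L + real n) \<eta> k) \<longlonglongrightarrow> (1 / 2) ^ k"
proof -
  have factor: "(\<lambda>n. (of_real (L + real n + 1) - \<i> * of_real \<eta> + of_nat j)
        / (of_real (2 * (L + real n) + 2) + of_nat j)) \<longlonglongrightarrow> (1 / 2 :: complex)" for j
  proof -
    have "(\<lambda>n. (L + real n + 1 + real j) / (2 * (L + real n) + 2 + real j)) \<longlonglongrightarrow> 1 / 2"
      by real_asymp
    moreover have "(\<lambda>n. \<eta> / (2 * (L + real n) + 2 + real j)) \<longlonglongrightarrow> 0"
      by real_asymp
    ultimately have "(\<lambda>n. of_real ((L + real n + 1 + real j) / (2 * (L + real n) + 2 + real j))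
        - \<i> * of_real (\<eta> / (2 * (L + real n) + 2 + real j))) \<longlonglongrightarrow> of_real (1 / 2) - \<i> * of_real 0"
      by (intro tendsto_diff tendsto_mult tendsto_of_real tendsto_const)
    moreover have "of_real ((L + real n + 1 + real j) / (2 * (L + real n) + 2 + real j))
          - \<i> * of_real (\<eta> / (2 * (L + real n) + 2 + real j))
        = (of_real (L + real n + 1) - \<i> * of_real \<eta> + of_nat j)
          / (of_real (2 * (L + real n) + 2) + of_nat j)" for n
      by (simp add: diff_divide_distrib add_divide_distrib)
    ultimately show ?thesis by (simp only:) simp
  qed
  have "(\<lambda>n. \<Prod>j<k. (of_real (L + real n + 1) - \<i> * of_real \<eta> + of_nat j)
        / (of_real (2 * (L + real n) + 2) + of_nat j)) \<longlonglongrightarrow> (\<Prod>j<k. 1 / 2 :: complex)"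
    by (intro tendsto_prod factor)
  moreover have "eventually (\<lambda>n. L + real n > -1) sequentially"
    by real_asymp
  hence "eventually (\<lambda>n. (\<Prod>j<k. (of_real (L + real n + 1) - \<i> * of_real \<eta> + of_nat j)
        / (of_real (2 * (L + real n) + 2) + of_nat j)) = coulomb_coeff (L + real n) \<eta> k) sequentially"
  proof eventually_elim
    case (elim n)
    hence "L + real n \<noteq> -1" by simp
    from coulomb_coeff_conv_pochhammer[OF this] show ?case
      by (simp only: pochhammer_prod atLeast0LessThan prod_dividef)
  qed
  ultimately show ?thesis by (simp add: Lim_transform_eventually)
qed

text \<open>By Tannery's theorem the limits \<open>(1 / 2) ^ k\<close> of the coefficients turn the
  series in \<open>2 * \<i> * \<rho>\<close> into that of \<open>exp (\<i> * \<rho>)\<close>, which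
  is then divided out.\<close>

lemma coulomb_phi_tendsto_1: "(\<lambda>n. coulomb_phi (L + real n) \<eta> \<rho>) \<longlonglongrightarrow> 1"
proof -
  define z where "z = 2 * \<i> * \<rho>"
  have ev: "eventually (\<lambda>n. L + real n + 1 > \<bar>\<eta>\<bar>) sequentially"
    by real_asymp
  have "(\<lambda>n. \<Sum>k. coulomb_coeff (L + real n) \<eta> k * (z ^ k / fact k))
      \<longlonglongrightarrow> (\<Sum>k. (1 / 2) ^ k * (z ^ k / fact k))"
  proof (rule tannerys_theorem[THEN conjunct2, THEN conjunct2])
    show "summable (\<lambda>n. norm z ^ n / fact n)"
      using summable_exp[of "norm z"] by (simp add: field_simps)
    show "\<forall>\<^sub>F (k, n) in at_top \<times>\<^sub>F sequentially.
        norm (coulomb_coeff (L + real n) \<eta> k * (z ^ k / fact k)) \<le> norm z ^ k / fact k"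
      unfolding eventually_prod_filter
    proof (intro exI conjI allI impI)
      show "eventually (\<lambda>_. True) at_top" by simp
      fix k n assume "L + real n + 1 > \<bar>\<eta>\<bar>"
      thus "case (k, n) of (k, n) \<Rightarrow>
          norm (coulomb_coeff (L + real n) \<eta> k * (z ^ k / fact k)) \<le> norm z ^ k / fact k"
        using mult_right_mono[OF norm_coulomb_coeff_le, of \<eta> "L + real n" "norm z ^ k / fact k" k]
        by (simp add: norm_mult norm_divide norm_power)
    qed (fact ev)
    show "(\<lambda>n. coulomb_coeff (L + real n) \<eta> k * (z ^ k / fact k)) \<longlonglongrightarrow> (1 / 2) ^ k * (z ^ k / fact k)" for k
      by (intro tendsto_intros coulomb_coeff_tendsto)
  qed auto
  moreover have "(\<lambda>k. (1 / 2) ^ k * (z ^ k / fact k)) sums exp (\<i> * \<rho>)"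
  proof -
    have "1 / 2 * z = \<i> * \<rho>" by (simp add: z_def)
    moreover have "(1 / 2) ^ k * (z ^ k / fact k) = (1 / 2 * z) ^ k / fact k" for k
      by (simp only: power_mult_distrib times_divide_eq_right)
    ultimately show ?thesis using exp_sums_complex[of "1 / 2 * z"] by (simp only:)
  qed
  ultimately have "(\<lambda>n. \<Sum>k. coulomb_coeff (L + real n) \<eta> k * (z ^ k / fact k)) \<longlonglongrightarrow> exp (\<i> * \<rho>)"
    by (simp add: sums_iff)
  moreover have "eventually (\<lambda>n. (\<Sum>k. coulomb_coeff (L + real n) \<eta> k * (z ^ k / fact k))
      = exp (\<i> * \<rho>) * coulomb_phi (L + real n) \<eta> \<rho>) sequentially"
    using ev by eventually_elim (unfold z_def, rule sums_unique[symmetric], rule coulomb_phi_series, auto)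
  ultimately have "(\<lambda>n. exp (\<i> * \<rho>) * coulomb_phi (L + real n) \<eta> \<rho>) \<longlonglongrightarrow> exp (\<i> * \<rho>)"
    by (rule Lim_transform_eventually)
  hence "(\<lambda>n. exp (\<i> * \<rho>) * coulomb_phi (L + real n) \<eta> \<rho> / exp (\<i> * \<rho>)) \<longlonglongrightarrow> exp (\<i> * \<rho>) / exp (\<i> * \<rho>)"
    by (intro tendsto_intros) auto
  thus ?thesis by simp
qed

section \<open>Normalising constants\<close>

text \<open>The functional equation of Gamma is applied once above and twice below. The divisor is
  \<open>L + 1\<close> itself, not its absolute value, so signs are kept.\<close>

lemma coulomb_C_Suc:
  assumes "L > -3/2" and "L \<noteq> -1"
  shows "coulomb_C (L + 1) \<eta> = coulomb_C L \<eta> * sqrt ((L + 1)\<^sup>2 + \<eta>\<^sup>2) / ((L + 1) * (2 * L + 3))"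
proof -
  \<comment> \<open>The real part exceeds -1/2 and is not 0, so no pole of Gamma is met.\<close>
  have "Complex (L + 1) \<eta> \<notin> \<int>\<^sub>\<le>\<^sub>0"
  proof
    assume "Complex (L + 1) \<eta> \<in> \<int>\<^sub>\<le>\<^sub>0"
    then obtain k where "Complex (L + 1) \<eta> = - of_nat k" by (elim nonpos_Ints_cases')
    hence "L + 1 = - real k" by (simp add: complex_eq_iff)
    with assms show False by (cases k) auto
  qed
  hence "Gamma (Complex (L + 1) \<eta> + 1) = Complex (L + 1) \<eta> * Gamma (Complex (L + 1) \<eta>)"
    by (rule Gamma_plus1)
  moreover have "Complex (L + 1) \<eta> + 1 = Complex (L + 1 + 1) \<eta>" by (simp add: complex_eq_iff)
  ultimately have "norm (Gamma (Complex (L + 1 + 1) \<eta>))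
      = sqrt ((L + 1)\<^sup>2 + \<eta>\<^sup>2) * norm (Gamma (Complex (L + 1) \<eta>))"
    by (simp add: norm_mult complex_norm)
  moreover have "Gamma (2 * (L + 1) + 2) = (2 * L + 3) * ((2 * L + 2) * Gamma (2 * L + 2))"
  proof -
    have "2 * L + 2 \<notin> \<int>\<^sub>\<le>\<^sub>0"
    proof
      assume "2 * L + 2 \<in> \<int>\<^sub>\<le>\<^sub>0"
      then obtain k where "2 * L + 2 = - real k" by (elim nonpos_Ints_cases')
      with assms show False by (cases k) auto
    qed
    moreover have "2 * L + 3 \<notin> \<int>\<^sub>\<le>\<^sub>0" using assms by (auto dest: nonpos_Ints_nonpos)
    ultimately show ?thesis
      using Gamma_plus1[of "2 * L + 2"] Gamma_plus1[of "2 * L + 3"]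
      by (simp add: algebra_simps)
  qed
  moreover have "L + 1 \<noteq> -1" using assms by auto
  ultimately show ?thesis using assms
    by (simp add: coulomb_C_def powr_add divide_simps)
qed

text \<open>Raising the order by 1 multiplies \<open>sqrt (2 * L + 1) * coulomb_C L \<eta>\<close>
  by one weight, so these quantities telescope.\<close>

lemma coulomb_C_Suc_w:
  assumes "L > -1/2"
  shows "sqrt (2 * L + 3) * coulomb_C (L + 1) \<eta> = sqrt (2 * L + 1) * coulomb_w \<eta> L * coulomb_C L \<eta>"
proof -
  have "sqrt ((2 * L + 1) * (2 * L + 3)) = sqrt (2 * L + 1) * sqrt (2 * L + 3)"
    by (rule real_sqrt_mult)
  moreover have "sqrt (2 * L + 3) * sqrt (2 * L + 3) = 2 * L + 3" using assms by simp
  moreover have "sqrt (2 * L + 3) > 0" "sqrt (2 * L + 1) > 0" "L + 1 > 0" using assms by auto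
  ultimately show ?thesis using assms
    by (simp add: coulomb_C_Suc coulomb_w_def divide_simps)
qed

text \<open>The telescoping starts at order \<open>L + 1 > -1/2\<close>, inside the range of
  \<open>coulomb_C_Suc_w\<close>, and collects exactly the weights that rescale
  \<open>coulomb_R L \<eta> n\<close>.\<close>

lemma coulomb_C_prod_w:
  assumes "L > -3/2"
  shows "sqrt ((2 * L + 3) * (2 * L + 2 * real n + 3)) * coulomb_C (L + real n + 1) \<eta>
    = (2 * L + 3) * coulomb_C (L + 1) \<eta> * (\<Prod>k<n. coulomb_w \<eta> (L + real k + 1))"
proof (induction n)
  case 0
  show ?case using assms by simp
next
  case (Suc n)
  show ?case
  proof -
    define x where "x = L + real n + 1"
    have "sqrt ((2 * L + 3) * (2 * L + 2 * real (Suc n) + 3)) * coulomb_C (L + real (Suc n) + 1) \<eta>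
        = sqrt (2 * L + 3) * (sqrt (2 * x + 3) * coulomb_C (x + 1) \<eta>)"
      by (simp add: x_def real_sqrt_mult add_ac)
    also have "\<dots> = sqrt (2 * L + 3) * (sqrt (2 * x + 1) * coulomb_w \<eta> x * coulomb_C x \<eta>)"
      using assms by (subst coulomb_C_Suc_w) (auto simp: x_def)
    also have "\<dots> = sqrt ((2 * L + 3) * (2 * L + 2 * real n + 3)) * coulomb_C (L + real n + 1) \<eta> * coulomb_w \<eta> x"
      by (simp add: x_def real_sqrt_mult add_ac)
    also have "\<dots> = (2 * L + 3) * coulomb_C (L + 1) \<eta> * (\<Prod>k<Suc n. coulomb_w \<eta> (L + real k + 1))"
      by (simp only: Suc prod.lessThan_Suc x_def mult.assoc)
    finally show ?thesis .
  qed
qed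

text \<open>The remaining step, from order \<open>L\<close> to \<open>L + 1\<close>, creates the
  sign: the square root contributes the absolute value of \<open>L + 1\<close>, whereas
  \<open>coulomb_C_Suc\<close> divides by \<open>L + 1\<close>.\<close>

lemma coulomb_C_base:
  assumes "L > -3/2" and "\<eta> \<noteq> 0 \<Longrightarrow> L \<noteq> -1"
  shows "(2 * L + 3) * coulomb_C (L + 1) \<eta>
    = (if L < -1 then -1 else 1) * sqrt (1 + \<eta>\<^sup>2 / (L + 1)\<^sup>2) * coulomb_C L \<eta>"
proof (cases "L = -1")
  case True
  \<comment> \<open>Both sides equal 1 here, the left by \<open>Gamma 2 = 1\<close> and the right by
    the limit value chosen for \<open>coulomb_C (-1) 0\<close>.\<close>
  hence "\<eta> = 0" using assms by auto
  moreover have "Complex 1 0 = 1" by (simp add: complex_eq_iff)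
  moreover have "Gamma (2 :: real) = 1" using Gamma_fact[of 1, where 'a = real] by simp
  ultimately show ?thesis using True by (simp add: coulomb_C_def)
next
  case False
  have "sqrt (1 + \<eta>\<^sup>2 / (L + 1)\<^sup>2) = sqrt (((L + 1)\<^sup>2 + \<eta>\<^sup>2) / (L + 1)\<^sup>2)"
    using False by (simp add: add_divide_distrib)
  also have "\<dots> = sqrt ((L + 1)\<^sup>2 + \<eta>\<^sup>2) / \<bar>L + 1\<bar>"
    by (simp add: real_sqrt_divide)
  finally have "(if L < -1 then -1 else 1) * sqrt (1 + \<eta>\<^sup>2 / (L + 1)\<^sup>2) = sqrt ((L + 1)\<^sup>2 + \<eta>\<^sup>2) / (L + 1)"
    by (simp only:) (auto simp: abs_if divide_simps)
  moreover have "(2 * L + 3) * coulomb_C (L + 1) \<eta> = sqrt ((L + 1)\<^sup>2 + \<eta>\<^sup>2) / (L + 1) * coulomb_C L \<eta>"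
    using False assms(1) by (simp add: coulomb_C_Suc)
  ultimately show ?thesis by (simp only:)
qed

section \<open>Convergence of the rescaled polynomials\<close>

lemma summable_coulomb_lambda: "summable (\<lambda>n. norm (coulomb_lambda \<eta> (L + real n + 1)))"
proof (rule summable_comparison_test_bigo)
  show "summable (\<lambda>n. norm (1 / real n ^ 2))"
    using inverse_power_summable[of 2, where 'a = real] by (simp add: field_simps)
  show "(\<lambda>n. norm (coulomb_lambda \<eta> (L + real n + 1))) \<in> O(\<lambda>n. 1 / real n ^ 2)"
    unfolding coulomb_lambda_def real_norm_def landau_o.big.abs_in_iff by real_asymp
qed

lemma summable_coulomb_w_squared: "summable (\<lambda>n. (coulomb_w \<eta> (L + real n + 1))\<^sup>2)"
proof (rule summable_comparison_test_bigo)
  show "summable (\<lambda>n. norm (1 / real n ^ 2))"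
    using inverse_power_summable[of 2, where 'a = real] by (simp add: field_simps)
  show "(\<lambda>n. (coulomb_w \<eta> (L + real n + 1))\<^sup>2) \<in> O(\<lambda>n. 1 / real n ^ 2)"
    unfolding coulomb_w_def by real_asymp
qed

text \<open>The rescaling clears the weights and the powers of \<open>1 / \<rho>\<close>;
  \<open>\<beta>\<close> and \<open>\<gamma>\<close> are then the coefficients in
  \<open>coulomb_phi_rec\<close>, and \<open>continuants_tendsto\<close> applies.\<close>

lemma coulomb_R_tendsto:
  assumes "L > -3/2" and "\<eta> \<noteq> 0 \<Longrightarrow> L \<noteq> -1" and "\<rho> \<noteq> 0"
  shows "(\<lambda>n. of_real (\<Prod>k<n. coulomb_w \<eta> (L + real k + 1)) * \<rho> ^ n * coulomb_R L \<eta> n \<rho>)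
    \<longlonglongrightarrow> coulomb_phi L \<eta> \<rho>"
proof -
  define \<beta> where "\<beta> n = 1 - complex_of_real (coulomb_lambda \<eta> (L + real n + 1)) * \<rho>" for n
  define \<gamma> where "\<gamma> n = \<rho>\<^sup>2 * complex_of_real ((coulomb_w \<eta> (L + real n + 1))\<^sup>2)" for n
  define W where "W n = complex_of_real (\<Prod>k<n. coulomb_w \<eta> (L + real k + 1))" for n
  define y where "y n = W n * \<rho> ^ n * coulomb_R L \<eta> n \<rho>" for n
  have W_Suc: "W (Suc n) = W n * of_real (coulomb_w \<eta> (L + real n + 1))" for n
    by (simp add: W_def)
  have "y \<longlonglongrightarrow> coulomb_phi (L + real 0) \<eta> \<rho>"
  proof (rule continuants_tendsto[where \<beta> = \<beta> and \<gamma> = \<gamma>])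
    show "coulomb_phi (L + real n) \<eta> \<rho> = \<beta> n * coulomb_phi (L + real (n + 1)) \<eta> \<rho>
        - \<gamma> n * coulomb_phi (L + real (n + 2)) \<eta> \<rho>" for n
    proof -
      have "\<eta> \<noteq> 0 \<Longrightarrow> L + real n \<noteq> -1"
        using assms by (cases n) auto
      thus ?thesis
        using coulomb_phi_rec[of "L + real n" \<eta> \<rho>] assms(1) by (simp add: \<beta>_def \<gamma>_def add_ac)
    qed
    show "y 0 = 1" by (simp add: y_def W_def coulomb_R_def)
    show "y 1 = \<beta> 0"
      using coulomb_P_recurrence[OF assms(1), of "1 / \<rho>" \<eta> 0] assms(3)
      by (simp add: y_def W_def coulomb_R_def \<beta>_def field_simps del: coulomb_P.simps(2))
    show "y (n + 2) = \<beta> (n + 1) * y (n + 1) - \<gamma> n * y n" for n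
    proof -
      define p q r w w' l where "p = coulomb_R L \<eta> n \<rho>" and "q = coulomb_R L \<eta> (n + 1) \<rho>"
        and "r = coulomb_R L \<eta> (n + 2) \<rho>" and "w = complex_of_real (coulomb_w \<eta> (L + real n + 1))"
        and "w' = complex_of_real (coulomb_w \<eta> (L + real n + 2))"
        and "l = complex_of_real (coulomb_lambda \<eta> (L + real n + 2))"
      have "1 / \<rho> * q = w * p + l * q + w' * r"
        using coulomb_P_recurrence[OF assms(1), of "1 / \<rho>" \<eta> "n + 1"]
        by (simp add: p_def q_def r_def w_def w'_def l_def coulomb_R_def add_ac del: coulomb_P.simps)
      hence "w' * r = (1 / \<rho> - l) * q - w * p" by (simp add: algebra_simps)
      \<comment> \<open>One factor \<open>w * \<rho>\<close> of \<open>\<gamma> n\<close> appears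
        here; the other is the ratio between the prefactors of \<open>y (n + 1)\<close> and
        \<open>y n\<close>.\<close>
      hence "\<rho> * (w' * r) = (1 - l * \<rho>) * q - w * \<rho> * p"
        using assms(3) by (simp add: field_simps)
      moreover have "y (n + 2) = W n * w * \<rho> ^ (n + 1) * (\<rho> * (w' * r))"
        using W_Suc[of n] W_Suc[of "n + 1"] by (simp add: y_def w_def w'_def r_def add_ac mult_ac)
      moreover have "y (n + 1) = W n * w * \<rho> ^ (n + 1) * q" "y n = W n * \<rho> ^ n * p"
        using W_Suc[of n] by (simp_all add: y_def w_def q_def p_def)
      moreover have "\<beta> (n + 1) = 1 - l * \<rho>" "\<gamma> n = \<rho>\<^sup>2 * w\<^sup>2"
        by (simp_all add: \<beta>_def \<gamma>_def l_def w_def add_ac)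
      ultimately show ?thesis by (simp only:) (simp add: power2_eq_square algebra_simps)
    qed
    show "summable (\<lambda>n. norm (\<beta> n - 1))"
      using summable_mult2[OF summable_coulomb_lambda, of \<eta> L "norm \<rho>"] by (simp add: \<beta>_def norm_mult)
    show "summable (\<lambda>n. norm (\<gamma> n))"
      using summable_mult[OF summable_coulomb_w_squared, of "norm (\<rho>\<^sup>2)" \<eta> L]
      by (simp add: \<gamma>_def norm_mult norm_power)
  qed (rule coulomb_phi_tendsto_1)
  thus ?thesis unfolding y_def[abs_def] W_def by simp
qed

theorem proposition8:
  fixes L \<eta> :: real and \<rho> :: complex
  assumes "L > - 3 / 2" and "\<eta> \<noteq> 0 \<Longrightarrow> L \<noteq> -1" and "\<rho> \<noteq> 0"
  shows "(\<lambda>n. of_real (sqrt ((2 * L + 3) * (2 * L + 2 * real n + 1)))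
              * of_real (coulomb_C (L + real n) \<eta>) * \<rho> powr of_real (L + real n)
              * coulomb_R L \<eta> (n - 1) \<rho>)
         \<longlonglongrightarrow> (if L < -1 then -1 else 1)
              * of_real (sqrt (1 + \<eta>\<^sup>2 / (L + 1)\<^sup>2)) * coulomb_F L \<eta> \<rho>"
proof -
  define c :: real where "c = (if L < -1 then -1 else 1) * sqrt (1 + \<eta>\<^sup>2 / (L + 1)\<^sup>2) * coulomb_C L \<eta>"
  define W where "W n = (\<Prod>k<n. coulomb_w \<eta> (L + real k + 1))" for n
  let ?a = "\<lambda>n. of_real (sqrt ((2 * L + 3) * (2 * L + 2 * real n + 1)))
              * of_real (coulomb_C (L + real n) \<eta>) * \<rho> powr of_real (L + real n)
              * coulomb_R L \<eta> (n - 1) \<rho>"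
  \<comment> \<open>Passing to \<open>n + 1\<close> turns the index \<open>n - 1\<close> into
    \<open>n\<close>, away from truncated subtraction at 0.\<close>
  have "?a (n + 1) = of_real c * \<rho> powr of_real (L + 1) * (of_real (W n) * \<rho> ^ n * coulomb_R L \<eta> n \<rho>)" for n
  proof -
    have "sqrt ((2 * L + 3) * (2 * L + 2 * real (n + 1) + 1)) * coulomb_C (L + real (n + 1)) \<eta> = c * W n"
      using coulomb_C_prod_w[OF assms(1), of n \<eta>] coulomb_C_base[OF assms(1,2)]
      by (simp add: c_def W_def add_ac)
    hence "complex_of_real (sqrt ((2 * L + 3) * (2 * L + 2 * real (n + 1) + 1)))
        * of_real (coulomb_C (L + real (n + 1)) \<eta>) = of_real c * of_real (W n)"
      by (metis of_real_mult)
    \<comment> \<open>Only the integer part \<open>n\<close> of the exponent is split off, so the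
      branch of the power is unaffected.\<close>
    moreover have "\<rho> powr of_real (L + real (n + 1)) = \<rho> powr of_real (L + 1) * \<rho> ^ n"
    proof -
      have "complex_of_real (L + real (n + 1)) = of_real (L + 1) + of_nat n" by simp
      thus ?thesis using assms(3) by (simp only: powr_add) (simp add: powr_nat')
    qed
    ultimately show ?thesis by (simp only: add_diff_cancel_right' mult_ac)
  qed
  moreover have "(\<lambda>n. of_real c * \<rho> powr of_real (L + 1) * (of_real (W n) * \<rho> ^ n * coulomb_R L \<eta> n \<rho>))
      \<longlonglongrightarrow> of_real c * \<rho> powr of_real (L + 1) * coulomb_phi L \<eta> \<rho>"
    unfolding W_def by (intro tendsto_mult tendsto_const coulomb_R_tendsto assms)
  ultimately have "(\<lambda>n. ?a (n + 1)) \<longlonglongrightarrow> of_real c * \<rho> powr of_real (L + 1) * coulomb_phi L \<eta> \<rho>"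
    by (simp only:)
  hence "?a \<longlonglongrightarrow> of_real c * \<rho> powr of_real (L + 1) * coulomb_phi L \<eta> \<rho>"
    by (rule LIMSEQ_offset)
  moreover have "of_real c * \<rho> powr of_real (L + 1) * coulomb_phi L \<eta> \<rho>
      = (if L < -1 then -1 else 1) * of_real (sqrt (1 + \<eta>\<^sup>2 / (L + 1)\<^sup>2)) * coulomb_F L \<eta> \<rho>"
    by (simp add: coulomb_F_def c_def)
  ultimately show ?thesis by (simp only:)
qed

end
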